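(* Let $(\Omega,\mathcal{A},\mu)$ be a measure space. For $i=1,\dots,n$, let $1<p_i<\infty$ be such that $p_1^{-1}+\cdots+p_n^{-1}=1$, and let $0\le f_i\in L^{p_i}(\mu)$ satisfy $\|f_i\|_{p_i}>0$. Let $p_{\max}=\max_{1\le i\le n}p_i$. Then $$\prod_{i=1}^n\|f_i\|_{p_i}\left(1-p_{\max}\sum_{i=1}^n\frac1{p_i}\left\|\frac{f_i^{p_i/2}}{\|f_i\|_{p_i}^{p_i/2}}-\sum_{k=1}^n\frac1{p_k}\frac{f_k^{p_k/2}}{\|f_k\|_{p_k}^{p_k/2}}\right\|_2^2\right)_+\le\left\|\prod_{i=1}^n f_i\right\|_1$$ and $$\left\|\prod_{i=1}^n f_i\right\|_1\le\prod_{i=1}^n\|f_i\|_{p_i}\left(1-\frac{p_{\max}}{p_{\max}-1}\sum_{i=1}^n\frac1{p_i}\left\|\frac{f_i^{p_i/2}}{\|f_i\|_{p_i}^{p_i/2}}-\sum_{k=1}^n\frac1{p_k}\frac{f_k^{p_k/2}}{\|f_k\|_{p_k}^{p_k/2}}\right\|_2^2\right).$$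
   Context: $\|\cdot\|_p$ denotes the norm of $L^p(\mu)$, and $(t)_+:=\max\{t,0\}$ for real $t$. *)

theory Defs
  imports "HOL-Analysis.Analysis"
begin

(* Elements of L^p are represented by functions, not by classes modulo null sets. *)
definition Lp :: "'a measure \<Rightarrow> real \<Rightarrow> ('a \<Rightarrow> real) set" where
  "Lp M p = {f. f \<in> borel_measurable M \<and> integrable M (\<lambda>x. \<bar>f x\<bar> powr p)}"

(* Meaningful only for f in Lp M p: the Bochner integral of a non-integrable function is 0. *)
definition Lp_norm :: "'a measure \<Rightarrow> real \<Rightarrow> ('a \<Rightarrow> real) \<Rightarrow> real" where
  "Lp_norm M p f = (LINT x|M. \<bar>f x\<bar> powr p) powr (1 / p)"

definition normalized_half_power ::
    "'a measure \<Rightarrow> real \<Rightarrow> ('a \<Rightarrow> real) \<Rightarrow> 'a \<Rightarrow> real" where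
  "normalized_half_power M p f x = f x powr (p / 2) / Lp_norm M p f powr (p / 2)"

definition deviation ::
    "'a measure \<Rightarrow> nat \<Rightarrow> (nat \<Rightarrow> real) \<Rightarrow> (nat \<Rightarrow> 'a \<Rightarrow> real) \<Rightarrow> nat \<Rightarrow> 'a \<Rightarrow> real" where
  "deviation M n p f i x =
     normalized_half_power M (p i) (f i) x
       - (\<Sum>k=1..n. 1 / p k * normalized_half_power M (p k) (f k) x)"

end

(* Put h_i = f_i^(p_i/2) / ||f_i||^(p_i/2), w_i = 1/p_i, c = 1/p_max = min w_i, and write E for the
   mean with weights w_i and G for the weighted geometric mean of the h_i. Since the integral of
   h_i^2 is 1 and the product of the f_i is G^2 times the product of the norms, both inequalities
   follow by integrating the pointwise bounds
     c E(h^2) + (1 - c) G^2 <= (E h)^2 <= (1 - c) E(h^2) + c G^2.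
   On the left, (E h)^2 - c E(h^2) is a quadratic form in h with nonnegative coefficients, so AM-GM
   applies. The right one is proved by induction on the number of points: replacing all values but
   the smallest by their geometric mean reduces it to two points. *)
theory Submission
  imports Defs
begin

section \<open>Variance identity and lower bound for the squared weighted mean\<close>

text \<open>Turns the weighted sum of squared deviations in the theorem into E(h^2) - (E h)^2, which
  the two pointwise bounds control.\<close>

lemma variance_eq:
  fixes w h :: "'i \<Rightarrow> real"
  assumes "(\<Sum>i\<in>S. w i) = 1"
  shows "(\<Sum>i\<in>S. w i * (h i - (\<Sum>k\<in>S. w k * h k))\<^sup>2)
       = (\<Sum>i\<in>S. w i * (h i)\<^sup>2) - (\<Sum>i\<in>S. w i * h i)\<^sup>2"
proof -
  define m where "m = (\<Sum>k\<in>S. w k * h k)"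
  have "(\<Sum>i\<in>S. w i * (h i - m)\<^sup>2)
      = (\<Sum>i\<in>S. w i * (h i)\<^sup>2 - 2 * m * (w i * h i) + m\<^sup>2 * w i)"
    by (intro sum.cong refl) (simp add: power2_eq_square algebra_simps)
  also have "\<dots> = (\<Sum>i\<in>S. w i * (h i)\<^sup>2) - 2 * m * m + m\<^sup>2 * 1"
    using assms
    by (simp add: sum.distrib sum_subtractf flip: sum_distrib_left m_def)
  finally show ?thesis
    by (simp add: m_def power2_eq_square)
qed

text \<open>Subtracting \<open>c * w i\<close> from the diagonal of the matrix
  \<open>w i * w j\<close> keeps it nonnegative because \<open>c \<le> w i\<close>, and leaves
  marginals \<open>(1 - c) * w i\<close>. AM-GM over pairs with these coefficients therefore
  produces \<open>G\<^sup>2\<close> with total mass \<open>1 - c\<close>. The case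
  \<open>c = 0\<close> is ordinary weighted AM-GM, squared, and is used in that form later.\<close>

lemma square_weighted_mean_ge:
  fixes w h :: "'i \<Rightarrow> real"
  assumes fin: "finite S" and sum_w: "(\<Sum>i\<in>S. w i) = 1"
    and c: "0 \<le> c" "c \<le> 1" "\<And>i. i \<in> S \<Longrightarrow> c \<le> w i"
    and h: "\<And>i. i \<in> S \<Longrightarrow> 0 \<le> h i"
  shows "c * (\<Sum>i\<in>S. w i * (h i)\<^sup>2) + (1 - c) * (\<Prod>i\<in>S. h i powr w i)\<^sup>2
       \<le> (\<Sum>i\<in>S. w i * h i)\<^sup>2"
proof -
  define a where "a i j = w i * w j - (if j = i then c * w i else 0)" for i j
  define G where "G = (\<Prod>i\<in>S. h i powr w i)"
  have a_nonneg: "0 \<le> a i j" if "i \<in> S" "j \<in> S" for i j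
  proof -
    have "c * w i \<le> w i * w i"
      using c(1) c(3)[OF that(1)] by (intro mult_right_mono) auto
    moreover have "0 \<le> w i * w j"
      using c(1) c(3)[OF that(1)] c(3)[OF that(2)] by (intro mult_nonneg_nonneg) auto
    ultimately show ?thesis
      unfolding a_def by auto
  qed
  have row: "(\<Sum>j\<in>S. a i j) = (1 - c) * w i" if "i \<in> S" for i
    using that fin sum_w
    by (simp add: a_def sum_subtractf flip: sum_distrib_left) (simp add: algebra_simps)
  have sym: "a i j = a j i" for i j
    by (simp add: a_def)
  have col: "(\<Sum>i\<in>S. a i j) = (1 - c) * w j" if "j \<in> S" for j
    using row[OF that] by (subst sym)
  have form: "(\<Sum>i\<in>S. w i * h i)\<^sup>2 - c * (\<Sum>i\<in>S. w i * (h i)\<^sup>2)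
            = (\<Sum>i\<in>S. \<Sum>j\<in>S. a i j * (h i * h j))"
  proof -
    have "(\<Sum>j\<in>S. a i j * (h i * h j)) = w i * h i * (\<Sum>j\<in>S. w j * h j) - c * (w i * (h i)\<^sup>2)"
      if "i \<in> S" for i
    proof -
      have "(\<Sum>j\<in>S. a i j * (h i * h j))
          = (\<Sum>j\<in>S. w i * h i * (w j * h j) - (if j = i then c * (w i * (h i)\<^sup>2) else 0))"
        by (intro sum.cong refl) (simp add: a_def power2_eq_square algebra_simps)
      then show ?thesis
        using that fin by (simp add: sum_subtractf flip: sum_distrib_left)
    qed
    then show ?thesis
      by (simp add: sum_subtractf power2_eq_square flip: sum_distrib_left sum_distrib_right)
  qed
  show ?thesis
  \<comment> \<open>Logarithms need positive values. If some value vanishes then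
    \<open>G = 0\<close>, even when its weight is zero, since \<open>0 powr 0 = 0\<close>.\<close>
  proof (cases "\<exists>i\<in>S. h i = 0")
    case True
    then have "G = 0"
      using fin by (auto simp: G_def prod_zero_iff)
    moreover have "0 \<le> (\<Sum>i\<in>S. \<Sum>j\<in>S. a i j * (h i * h j))"
      using a_nonneg h by (intro sum_nonneg mult_nonneg_nonneg) auto
    ultimately show ?thesis
      using form unfolding G_def by auto
  next
    case False
    then have pos: "0 < h i" if "i \<in> S" for i
      using h that by (metis less_eq_real_def)
    define l where "l = (\<Sum>i\<in>S. w i * ln (h i))"
    have G: "G = exp l"
      unfolding G_def l_def exp_sum[OF fin]
      by (intro prod.cong refl) (use False in \<open>auto simp: powr_def\<close>)
    \<comment> \<open>weighted AM-GM for the products \<open>h i * h j\<close>, from \<open>1 + ln t \<le> t\<close> at \<open>t = h i * h j / G\<^sup>2\<close>\<close>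
    have tangent: "G\<^sup>2 * (1 - 2 * l + ln (h i) + ln (h j)) \<le> h i * h j" if "i \<in> S" "j \<in> S" for i j
    proof -
      have "G\<^sup>2 * (1 + (ln (h i) + ln (h j) - 2 * l)) \<le> G\<^sup>2 * exp (ln (h i) + ln (h j) - 2 * l)"
        by (intro mult_left_mono exp_ge_add_one_self) auto
      also have "\<dots> = h i * h j"
        using pos[OF that(1)] pos[OF that(2)]
        by (simp add: G exp_diff exp_add exp_double)
      finally show ?thesis
        by (simp add: algebra_simps)
    qed
    \<comment> \<open>Both marginals of \<open>a\<close> are \<open>(1 - c) * w\<close>, so the two
      logarithms summed against \<open>a\<close> give \<open>2 * (1 - c) * l\<close>. This cancels
      the term \<open>- 2 * l\<close> of the tangent bound, leaving
      \<open>(1 - c) * G\<^sup>2\<close>.\<close>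
    have row_ln: "(\<Sum>i\<in>S. \<Sum>j\<in>S. a i j * ln (h i)) = (1 - c) * l"
      by (simp add: row l_def sum_distrib_left mult.assoc flip: sum_distrib_right)
    have col_ln: "(\<Sum>i\<in>S. \<Sum>j\<in>S. a i j * ln (h j)) = (1 - c) * l"
      by (subst sum.swap) (simp add: col l_def sum_distrib_left mult.assoc flip: sum_distrib_right)
    have total: "(\<Sum>i\<in>S. \<Sum>j\<in>S. a i j) = 1 - c"
      using sum_w by (simp add: row flip: sum_distrib_left)
    have "(\<Sum>i\<in>S. \<Sum>j\<in>S. a i j * (G\<^sup>2 * (1 - 2 * l + ln (h i) + ln (h j))))
        = (\<Sum>i\<in>S. \<Sum>j\<in>S. G\<^sup>2 * ((1 - 2 * l) * a i j + a i j * ln (h i) + a i j * ln (h j)))"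
      by (simp add: algebra_simps)
    also have "\<dots> = G\<^sup>2 * ((1 - 2 * l) * (1 - c) + (1 - c) * l + (1 - c) * l)"
      by (simp only: sum.distrib row_ln col_ln total flip: sum_distrib_left)
    also have "\<dots> = (1 - c) * G\<^sup>2"
      by algebra
    finally have "(1 - c) * G\<^sup>2 = (\<Sum>i\<in>S. \<Sum>j\<in>S. a i j * (G\<^sup>2 * (1 - 2 * l + ln (h i) + ln (h j))))"
      by simp
    also have "\<dots> \<le> (\<Sum>i\<in>S. \<Sum>j\<in>S. a i j * (h i * h j))"
      using tangent a_nonneg by (intro sum_mono mult_left_mono) auto
    finally show ?thesis
      using form unfolding G_def by linarith
  qed
qed

section \<open>Upper bound for the squared weighted mean: two points, then finitely many\<close>

lemma weighted_AM_GM_2: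
  fixes x y a b :: real
  assumes "0 < a" "0 < b" "a + b = 1" "0 \<le> x" "0 \<le> y"
  shows "x powr a * y powr b \<le> a * x + b * y"
proof (cases "x = 0 \<or> y = 0")
  case True
  then show ?thesis
    using assms by auto
next
  case False
  then show ?thesis
    using assms by (intro Youngs_inequality_0) auto
qed

text \<open>For \<open>c = a \<le> b\<close>, right-hand side minus left-hand side is
  \<open>a * ((b - a) * x\<^sup>2 + G\<^sup>2 - 2 * b * x * y)\<close> with \<open>G\<close> the
  geometric mean, and the bracket is nonnegative by AM-GM for \<open>x\<^sup>2\<close> and
  \<open>G\<^sup>2\<close>.\<close>

lemma square_weighted_mean_2_le:
  fixes x y a b :: real
  assumes ab: "0 < a" "0 < b" "a + b = 1" and c: "c \<le> a" "c \<le> b" and xy: "0 \<le> x" "0 \<le> y"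
  shows "(a * x + b * y)\<^sup>2 \<le> (1 - c) * (a * x\<^sup>2 + b * y\<^sup>2) + c * (x powr a * y powr b)\<^sup>2"
proof -
  have small: "(a * x + b * y)\<^sup>2 \<le> b * (a * x\<^sup>2 + b * y\<^sup>2) + a * (x powr a * y powr b)\<^sup>2"
    if ab: "0 < a" "a \<le> b" "a + b = 1" and xy: "0 \<le> x" "0 \<le> y" for a b x y :: real
  \<comment> \<open>Outside these cases all logarithms below are of positive numbers and the AM-GM
    weight \<open>(b - a) / s\<close> is positive.\<close>
  proof (cases "x = 0 \<or> y = 0 \<or> a = b")
    case True
    then show ?thesis
    proof (elim disjE)
      assume "x = 0"
      then show ?thesis by (simp add: power2_eq_square algebra_simps)
    next
      assume "y = 0"
      then show ?thesis
        using ab mult_right_mono[of a b "a * x\<^sup>2"] by (simp add: power2_eq_square ac_simps)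
    next
      assume "a = b"
      with ab have "a = 1/2" "b = 1/2" by auto
      then show ?thesis
        unfolding \<open>a = 1/2\<close> \<open>b = 1/2\<close> powr_half_sqrt[OF xy(1)] powr_half_sqrt[OF xy(2)]
        using xy by (simp add: power_mult_distrib) (simp add: power2_eq_square field_simps)
    qed
  next
    case False
    define G where "G = x powr a * y powr b"
    \<comment> \<open>The weights \<open>(b - a) / s\<close> and \<open>1 / s\<close> add up to 1
      because \<open>a + b = 1\<close>, and they make the geometric mean of \<open>x\<^sup>2\<close>
      and \<open>G\<^sup>2\<close> equal to \<open>x * y\<close>.\<close>
    define s where "s = 2 * b"
    have s: "0 < s" "(b - a) / s + 1 / s = 1"
      using ab by (auto simp: s_def field_simps)
    have "(x\<^sup>2) powr ((b - a) / s) * (G\<^sup>2) powr (1 / s) \<le> (b - a) / s * x\<^sup>2 + 1 / s * G\<^sup>2"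
      using ab s False by (intro weighted_AM_GM_2) auto
    also have "(x\<^sup>2) powr ((b - a) / s) * (G\<^sup>2) powr (1 / s) = x * y"
    proof -
      have "ln ((x\<^sup>2) powr ((b - a) / s) * (G\<^sup>2) powr (1 / s)) = ln (x * y)"
      proof -
        have "x > 0" "y > 0" "b > 0"
          using False xy ab by auto
        then have "ln ((x\<^sup>2) powr ((b - a) / s) * (G\<^sup>2) powr (1 / s))
            = (b - a) / s * (2 * ln x) + 1 / s * (2 * (a * ln x + b * ln y))"
          by (simp add: G_def ln_mult ln_powr ln_realpow)
        also have "\<dots> = ln x + ln y"
          using \<open>b > 0\<close> by (simp add: s_def field_simps)
        finally show ?thesis
          using \<open>x > 0\<close> \<open>y > 0\<close> by (simp add: ln_mult)
      qed
      moreover have "0 < (x\<^sup>2) powr ((b - a) / s) * (G\<^sup>2) powr (1 / s)" "0 < x * y"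
        using False xy by (auto simp: G_def)
      ultimately show ?thesis by simp
    qed
    finally have "2 * b * (x * y) \<le> (b - a) * x\<^sup>2 + G\<^sup>2"
      using s(1) by (simp add: s_def field_simps)
    then have "a * (2 * b * (x * y)) \<le> a * ((b - a) * x\<^sup>2 + G\<^sup>2)"
      using ab by (intro mult_left_mono) auto
    moreover have "b * (a * x\<^sup>2 + b * y\<^sup>2) + a * G\<^sup>2 - (a * x + b * y)\<^sup>2
        = a * ((b - a) * x\<^sup>2 + G\<^sup>2) - a * (2 * b * (x * y))"
      by algebra
    ultimately show ?thesis
      unfolding G_def by linarith
  qed
  have compl: "1 - a = b" "1 - b = a"
    using ab(3) by auto
  have "(a * x + b * y)\<^sup>2 \<le> (1 - min a b) * (a * x\<^sup>2 + b * y\<^sup>2) + min a b * (x powr a * y powr b)\<^sup>2"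
  proof (cases "a \<le> b")
    case True
    then show ?thesis
      using small[of a b x y] ab xy by (simp add: compl)
  next
    case False
    then show ?thesis
      using small[of b a y x] ab xy by (simp add: compl ac_simps)
  qed
  \<comment> \<open>Lowering \<open>c\<close> below \<open>min a b\<close> only increases the
    right-hand side, since the squared geometric mean is at most the mean of the squares.\<close>
  moreover have "0 \<le> (min a b - c) * ((a * x\<^sup>2 + b * y\<^sup>2) - (x powr a * y powr b)\<^sup>2)"
  proof (intro mult_nonneg_nonneg)
    have "(x powr a * y powr b)\<^sup>2 = (x\<^sup>2) powr a * (y\<^sup>2) powr b"
      using xy by (simp add: power_mult_distrib power2_eq_square powr_mult)
    then show "0 \<le> (a * x\<^sup>2 + b * y\<^sup>2) - (x powr a * y powr b)\<^sup>2"
      using weighted_AM_GM_2[of a b "x\<^sup>2" "y\<^sup>2"] ab by simp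
  qed (use c in auto)
  ultimately show ?thesis
    by (simp add: algebra_simps)
qed

text \<open>The same \<open>c\<close> serves throughout the induction: dividing the weights of the
  remaining points by their total \<open>q < 1\<close> only enlarges them, and \<open>q\<close>
  itself is at least one of these weights.\<close>

lemma square_weighted_mean_le:
  fixes w h :: "'i \<Rightarrow> real"
  assumes "finite S" and "(\<Sum>i\<in>S. w i) = 1"
    and "0 < c" "\<And>i. i \<in> S \<Longrightarrow> c \<le> w i"
    and "\<And>i. i \<in> S \<Longrightarrow> 0 \<le> h i"
  shows "(\<Sum>i\<in>S. w i * h i)\<^sup>2
       \<le> (1 - c) * (\<Sum>i\<in>S. w i * (h i)\<^sup>2) + c * (\<Prod>i\<in>S. h i powr w i)\<^sup>2"
  using assms
proof (induction "card S" arbitrary: S w rule: less_induct)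
  case (less S w)
  note fin = less.prems(1) and sum_w = less.prems(2) and c = less.prems(3,4) and h = less.prems(5)
  have "S \<noteq> {}"
    using sum_w by auto
  then obtain i where i: "i \<in> S" "\<And>j. j \<in> S \<Longrightarrow> h i \<le> h j"
    using arg_min_if_finite[OF fin, of h] by (metis linorder_not_less)
  define T where "T = S - {i}"
  have S: "S = insert i T" "i \<notin> T" "finite T"
    using i fin by (auto simp: T_def)
  have pos: "0 < w j" if "j \<in> S" for j
    using c that by force
  show ?case
  proof (cases "T = {}")
    case True
    then show ?thesis
      using S sum_w h i by (auto simp: algebra_simps)
  next
    case False
    define q where "q = (\<Sum>j\<in>T. w j)"
    have q: "w i + q = 1"
      using sum_w S by (simp add: q_def)
    have "c \<le> q"
    proof -
      obtain j where "j \<in> T" using False by blast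
      then have "w j \<le> q"
        unfolding q_def using S pos by (intro member_le_sum) (auto intro: less_imp_le)
      then show ?thesis
        using c(2)[of j] \<open>j \<in> T\<close> S by auto
    qed
    have q_pos: "0 < q" "q < 1"
      using \<open>c \<le> q\<close> c(1) q pos[OF i(1)] by auto
    define v where "v j = w j / q" for j
    define m where "m = (\<Sum>j\<in>T. v j * h j)"
    define m2 where "m2 = (\<Sum>j\<in>T. v j * (h j)\<^sup>2)"
    define g where "g = (\<Prod>j\<in>T. h j powr v j)"
    have sum_v: "(\<Sum>j\<in>T. v j) = 1"
      using q_pos by (simp add: v_def q_def flip: sum_divide_distrib)
    have v_ge: "c \<le> v j" if "j \<in> T" for j
    proof -
      have "w j \<le> v j"
        using q_pos pos[of j] that S by (simp add: v_def field_simps)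
      then show ?thesis using c(2)[of j] that S by auto
    qed
    have IH: "m\<^sup>2 \<le> (1 - c) * m2 + c * g\<^sup>2"
      unfolding m_def m2_def g_def
      by (rule less.hyps) (use S sum_v v_ge c(1) h in auto)
    have g_nonneg: "0 \<le> g"
      unfolding g_def by (intro prod_nonneg) auto
    have m_nonneg: "0 \<le> m"
      unfolding m_def using h S v_ge c(1) by (intro sum_nonneg mult_nonneg_nonneg) force+
    \<comment> \<open>The minimum lies below the geometric mean of the other values. Together with
      \<open>g_le_m\<close> this gives \<open>2 * h i \<le> m + g\<close>.\<close>
    have hi: "0 \<le> h i" "h i \<le> g"
    proof -
      show "0 \<le> h i" using h i by blast
      show "h i \<le> g"
      proof (cases "h i = 0")
        case True
        then show ?thesis using g_nonneg by simp
      next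
        case False
        then have "0 < h i" using \<open>0 \<le> h i\<close> by simp
        then have "h i = h i powr (\<Sum>j\<in>T. v j)"
          by (simp add: sum_v)
        also have "\<dots> = (\<Prod>j\<in>T. h i powr v j)"
          using \<open>0 < h i\<close> S(3) by (simp add: powr_sum)
        also have "\<dots> \<le> g"
          unfolding g_def
          by (intro prod_mono conjI powr_mono2) (use i(2) S v_ge c(1) \<open>0 \<le> h i\<close> in force)+
        finally show ?thesis .
      qed
    qed
    have g_le_m: "g \<le> m"
    proof -
      \<comment> \<open>AM-GM on \<open>T\<close>, as the instance \<open>c = 0\<close> of the lower
        bound.\<close>
      have "g\<^sup>2 \<le> m\<^sup>2"
        using square_weighted_mean_ge[of T v 0 h] S sum_v v_ge c(1) h
        unfolding m_def g_def by force
      then show ?thesis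
        using m_nonneg by (rule power2_le_imp_le)
    qed
    have two: "(w i * h i + q * g)\<^sup>2
        \<le> (1 - c) * (w i * (h i)\<^sup>2 + q * g\<^sup>2) + c * (h i powr w i * g powr q)\<^sup>2"
      by (intro square_weighted_mean_2_le) (use pos i c q q_pos \<open>c \<le> q\<close> hi g_nonneg in auto)
    have "(\<Sum>j\<in>T. w j * h j) = q * m" "(\<Sum>j\<in>T. w j * (h j)\<^sup>2) = q * m2"
      using q_pos by (auto simp: m_def m2_def v_def sum_distrib_left)
    then have sums: "(\<Sum>j\<in>S. w j * h j) = w i * h i + q * m"
        "(\<Sum>j\<in>S. w j * (h j)\<^sup>2) = w i * (h i)\<^sup>2 + q * m2"
      using S by auto
    have "g powr q = (\<Prod>j\<in>T. (h j powr v j) powr q)"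
      unfolding g_def by (rule prod_powr_distrib)
    also have "\<dots> = (\<Prod>j\<in>T. h j powr w j)"
      using q_pos by (simp add: powr_powr v_def)
    finally have prods: "(\<Prod>j\<in>S. h j powr w j) = h i powr w i * g powr q"
      using S by simp
    \<comment> \<open>replacing the values on \<open>T\<close> by their geometric mean does not increase
      (right-hand side minus left-hand side), because \<open>h i\<close> is smallest\<close>
    have "(w i * h i + q * m)\<^sup>2 - (w i * h i + q * g)\<^sup>2 \<le> q * (m\<^sup>2 - g\<^sup>2)"
    proof -
      have "2 * h i * (m - g) \<le> (m + g) * (m - g)"
        using hi g_le_m by (intro mult_right_mono) auto
      then have smallest: "w i * (2 * h i * (m - g)) \<le> w i * ((m + g) * (m - g))"
        using pos[OF i(1)] by (intro mult_left_mono) auto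
      have "(w i * h i + q * m)\<^sup>2 - (w i * h i + q * g)\<^sup>2
          = q * (w i * (2 * h i * (m - g)) + q * ((m + g) * (m - g)))"
        by algebra
      also have "\<dots> \<le> q * (w i * ((m + g) * (m - g)) + q * ((m + g) * (m - g)))"
        using q_pos by (intro mult_left_mono add_right_mono smallest) auto
      also have "\<dots> = q * (w i + q) * (m\<^sup>2 - g\<^sup>2)"
        by algebra
      finally show ?thesis
        using q by simp
    qed
    \<comment> \<open>The new expression is exactly what the right-hand side loses when
      \<open>g\<close> replaces the values on \<open>T\<close>: by \<open>prods\<close> its
      geometric-mean term stays the same.\<close>
    also have "\<dots> \<le> q * ((1 - c) * (m2 - g\<^sup>2))"
      using IH q_pos by (intro mult_left_mono) (auto simp: algebra_simps)
    finally show ?thesis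
      using two unfolding sums prods by (simp add: algebra_simps)
  qed
qed

section \<open>Normalized half powers and the norms\<close>

text \<open>The absolute value matches the integrand in \<open>Lp_norm\<close>, so that the squared
  half powers integrate to 1.\<close>

lemma normalized_half_power_sq:
  assumes "0 \<le> f x"
  shows "(normalized_half_power M p f x)\<^sup>2 = \<bar>f x\<bar> powr p / Lp_norm M p f powr p"
proof -
  have "(t powr (p / 2))\<^sup>2 = t powr p" for t :: real
    by (simp add: power2_eq_square flip: powr_add)
  then show ?thesis
    using assms by (simp add: normalized_half_power_def power_divide)
qed

lemma Lp_norm_powr:
  assumes "0 < p"
  shows "Lp_norm M p f powr p = (LINT x|M. \<bar>f x\<bar> powr p)"
  using assms by (simp add: Lp_norm_def powr_powr integral_nonneg_AE)

lemma Lp_norm_2_sq: "(Lp_norm M 2 f)\<^sup>2 = (LINT x|M. (f x)\<^sup>2)"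
  by (simp add: Lp_norm_def powr_half_sqrt integral_nonneg_AE)

lemma Lp_norm_1: "Lp_norm M 1 f = (LINT x|M. \<bar>f x\<bar>)"
  by (simp add: Lp_norm_def integral_nonneg_AE)

lemma borel_measurable_normalized_half_power [measurable]:
  assumes [measurable]: "f \<in> borel_measurable M"
  shows "normalized_half_power M p f \<in> borel_measurable M"
  unfolding normalized_half_power_def by measurable

section \<open>From the pointwise bounds to integrals\<close>

theorem corollary2p4:
  fixes M :: "'a measure" and n :: nat
    and p :: "nat \<Rightarrow> real" and f :: "nat \<Rightarrow> 'a \<Rightarrow> real" and p_max :: real
  assumes p_gt_1: "\<And>i. i \<in> {1..n} \<Longrightarrow> 1 < p i"
    and p_conj: "(\<Sum>i=1..n. 1 / p i) = 1"
    and f_nonneg: "\<And>i. i \<in> {1..n} \<Longrightarrow> AE x in M. 0 \<le> f i x"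
    and f_Lp: "\<And>i. i \<in> {1..n} \<Longrightarrow> f i \<in> Lp M (p i)"
    and f_norm_pos: "\<And>i. i \<in> {1..n} \<Longrightarrow> 0 < Lp_norm M (p i) (f i)"
    and p_max: "p_max = Max (p ` {1..n})"
  shows "(\<lambda>x. \<Prod>i=1..n. f i x) \<in> Lp M 1
       \<and> (\<forall>i\<in>{1..n}. deviation M n p f i \<in> Lp M 2)
       \<and> (\<Prod>i=1..n. Lp_norm M (p i) (f i))
           * max (1 - p_max * (\<Sum>i=1..n. 1 / p i * (Lp_norm M 2 (deviation M n p f i))\<^sup>2)) 0
         \<le> Lp_norm M 1 (\<lambda>x. \<Prod>i=1..n. f i x)
       \<and> Lp_norm M 1 (\<lambda>x. \<Prod>i=1..n. f i x)
         \<le> (\<Prod>i=1..n. Lp_norm M (p i) (f i))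
           * (1 - p_max / (p_max - 1)
                  * (\<Sum>i=1..n. 1 / p i * (Lp_norm M 2 (deviation M n p f i))\<^sup>2))"
proof -
  define S where "S = {1..n}"
  have fin: "finite S" by (simp add: S_def)
  define w where "w i = 1 / p i" for i
  define h where "h i = normalized_half_power M (p i) (f i)" for i
  define N where "N = (\<Prod>i\<in>S. Lp_norm M (p i) (f i))"
  define c where "c = 1 / p_max"
  define E2 where "E2 x = (\<Sum>i\<in>S. w i * (h i x)\<^sup>2)" for x
  define G2 where "G2 x = (\<Prod>i\<in>S. h i x powr w i)\<^sup>2" for x
  define d where "d i = deviation M n p f i" for i
  define V where "V = (\<Sum>i\<in>S. w i * (LINT x|M. (d i x)\<^sup>2))"
  have d_eq: "d i x = h i x - (\<Sum>k\<in>S. w k * h k x)" for i x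
    by (simp add: d_def deviation_def h_def w_def S_def)
  have p: "1 < p i" "0 < Lp_norm M (p i) (f i)" if "i \<in> S" for i
    using p_gt_1 f_norm_pos that by (auto simp: S_def)
  have w_pos: "0 < w i" if "i \<in> S" for i
    using p[OF that] by (simp add: w_def)
  have sum_w: "(\<Sum>i\<in>S. w i) = 1"
    using p_conj by (simp add: S_def w_def)
  then have "S \<noteq> {}" by auto
  then have "p_max \<in> p ` S"
    unfolding p_max S_def[symmetric] using fin by (intro Max_in) auto
  then have p_max_gt_1: "1 < p_max"
    using p by auto
  then have c: "0 < c" "c < 1"
    by (auto simp: c_def)
  have c_le: "c \<le> w i" if "i \<in> S" for i
  proof -
    have "p i \<le> p_max"
      unfolding p_max S_def[symmetric] using fin that by simp
    then show ?thesis
      using p[OF that] by (simp add: c_def w_def frac_le)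
  qed
  have [measurable]: "f i \<in> borel_measurable M" if "i \<in> S" for i
    using f_Lp that by (auto simp: Lp_def S_def)
  have [measurable]: "h i \<in> borel_measurable M" if "i \<in> S" for i
    using that unfolding h_def by measurable
  have [measurable]: "d i \<in> borel_measurable M" if "i \<in> S" for i
    unfolding d_eq[abs_def] using that by measurable
  have [measurable]: "G2 \<in> borel_measurable M" "E2 \<in> borel_measurable M"
    unfolding G2_def E2_def by measurable
  \<comment> \<open>True at every point because \<open>powr\<close> is never negative. The pointwise
    bounds thus hold everywhere, and the almost-everywhere sign of \<open>f i\<close> enters only in
    relating \<open>h i\<close> to \<open>f i\<close>.\<close>
  have h_nonneg: "0 \<le> h i x" for i x
    by (simp add: h_def normalized_half_power_def)
  have nonneg: "AE x in M. \<forall>i\<in>S. 0 \<le> f i x"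
    using f_nonneg fin by (intro AE_finite_allI) (auto simp: S_def)

  have h_sq: "integrable M (\<lambda>x. (h i x)\<^sup>2)" "(LINT x|M. (h i x)\<^sup>2) = 1" if i: "i \<in> S" for i
  proof -
    let ?g = "\<lambda>x. \<bar>f i x\<bar> powr p i / Lp_norm M (p i) (f i) powr p i"
    have g: "integrable M ?g"
      using f_Lp i by (auto simp: Lp_def S_def)
    have eq: "AE x in M. ?g x = (h i x)\<^sup>2"
      using nonneg i p[OF i] by (auto simp: h_def normalized_half_power_sq elim!: eventually_mono)
    show "integrable M (\<lambda>x. (h i x)\<^sup>2)"
      using g by (rule integrable_cong_AE_imp) (use eq i in auto)
    have "(LINT x|M. (h i x)\<^sup>2) = (LINT x|M. ?g x)"
      by (rule integral_cong_AE) (use eq i in auto)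
    also have "\<dots> = 1"
      using p[OF i] by (simp flip: Lp_norm_powr)
    finally show "(LINT x|M. (h i x)\<^sup>2) = 1" .
  qed
  have E2: "integrable M E2" "(LINT x|M. E2 x) = 1"
    unfolding E2_def using h_sq sum_w by auto

  have lower: "c * E2 x + (1 - c) * G2 x \<le> (\<Sum>i\<in>S. w i * h i x)\<^sup>2" for x
    unfolding E2_def G2_def using fin sum_w c c_le h_nonneg
    by (intro square_weighted_mean_ge) auto
  have upper: "(\<Sum>i\<in>S. w i * h i x)\<^sup>2 \<le> (1 - c) * E2 x + c * G2 x" for x
    unfolding E2_def G2_def using fin sum_w c c_le h_nonneg
    by (intro square_weighted_mean_le) auto
  have var: "(\<Sum>i\<in>S. w i * (d i x)\<^sup>2) = E2 x - (\<Sum>i\<in>S. w i * h i x)\<^sup>2" for x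
    unfolding d_eq E2_def by (rule variance_eq[OF sum_w])

  have G2_nonneg: "0 \<le> G2 x" for x
    by (simp add: G2_def)
  \<comment> \<open>The lower bound with \<open>c = 0\<close> puts \<open>G2\<close> below the
    squared mean, which is below \<open>E2\<close> because the variance is nonnegative.\<close>
  have G2_le: "G2 x \<le> E2 x" for x
    using square_weighted_mean_ge[of S w 0 "\<lambda>i. h i x"] fin sum_w w_pos h_nonneg var[of x]
      sum_nonneg[of S "\<lambda>i. w i * (d i x)\<^sup>2"]
    by (force simp: G2_def less_imp_le)
  have G2: "integrable M G2"
  proof (rule Bochner_Integration.integrable_bound[OF E2(1)])
    show "AE x in M. norm (G2 x) \<le> norm (E2 x)"
      using G2_le G2_nonneg by (intro AE_I2) (metis abs_of_nonneg order.trans real_norm_def)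
  qed simp

  have d_sq: "integrable M (\<lambda>x. (d i x)\<^sup>2)" if i: "i \<in> S" for i
  proof (rule Bochner_Integration.integrable_bound)
    show "integrable M (\<lambda>x. E2 x / w i)"
      using E2 by simp
    show "(\<lambda>x. (d i x)\<^sup>2) \<in> borel_measurable M"
      using i by measurable
    \<comment> \<open>One term of the variance is at most the variance, hence at most
      \<open>E2\<close>.\<close>
    have "w i * (d i x)\<^sup>2 \<le> E2 x" for x
    proof -
      have "w i * (d i x)\<^sup>2 \<le> (\<Sum>i\<in>S. w i * (d i x)\<^sup>2)"
        using i fin w_pos by (intro member_le_sum) (auto simp: less_imp_le)
      moreover have "0 \<le> (\<Sum>i\<in>S. w i * h i x)\<^sup>2" by simp
      ultimately show ?thesis unfolding var by linarith
    qed
    then have "(d i x)\<^sup>2 \<le> E2 x / w i" for x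
      using w_pos[OF i] by (simp add: field_simps)
    then have "norm ((d i x)\<^sup>2) \<le> norm (E2 x / w i)" for x
      by (metis abs_ge_self norm_power order.trans power2_abs real_norm_def)
    then show "AE x in M. norm ((d i x)\<^sup>2) \<le> norm (E2 x / w i)"
      by (rule AE_I2)
  qed
  have V: "V = (LINT x|M. (\<Sum>i\<in>S. w i * (d i x)\<^sup>2))"
    unfolding V_def using d_sq by simp
  have V_integrable: "integrable M (\<lambda>x. \<Sum>i\<in>S. w i * (d i x)\<^sup>2)"
    using d_sq by auto

  have prod_eq: "AE x in M. \<bar>\<Prod>i\<in>S. f i x\<bar> = N * G2 x"
    using nonneg
  proof eventually_elim
    case (elim x)
    \<comment> \<open>Raising \<open>(h i x)\<^sup>2\<close>, the normalized power of
      \<open>f i x\<close> with exponent \<open>p i\<close>, to the power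
      \<open>w i = 1 / p i\<close> undoes the exponent.\<close>
    have "f i x = Lp_norm M (p i) (f i) * (h i x powr w i)\<^sup>2" if "i \<in> S" for i
    proof -
      have "(h i x powr w i)\<^sup>2 = ((h i x)\<^sup>2) powr w i"
        using h_nonneg by (simp add: power2_eq_square powr_mult)
      also have "\<dots> = f i x / Lp_norm M (p i) (f i)"
        using elim that p[OF that]
        by (simp add: h_def normalized_half_power_sq powr_divide powr_powr w_def)
      finally show ?thesis
        using p[OF that] by simp
    qed
    then have "(\<Prod>i\<in>S. f i x) = N * G2 x"
      by (simp add: N_def G2_def prod.distrib prod_power_distrib)
    moreover have "0 \<le> (\<Prod>i\<in>S. f i x)"
      using elim by (intro prod_nonneg) auto
    ultimately show ?case by simp
  qed
  have norm_1: "Lp_norm M 1 (\<lambda>x. \<Prod>i\<in>S. f i x) = N * (LINT x|M. G2 x)"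
  proof -
    have "(LINT x|M. \<bar>\<Prod>i\<in>S. f i x\<bar>) = (LINT x|M. N * G2 x)"
      by (rule integral_cong_AE) (use prod_eq in auto)
    then show ?thesis by (simp add: Lp_norm_1)
  qed
  have prod_Lp: "(\<lambda>x. \<Prod>i\<in>S. f i x) \<in> Lp M 1"
  proof -
    have "integrable M (\<lambda>x. N * G2 x)"
      using G2 by simp
    then have "integrable M (\<lambda>x. \<bar>\<Prod>i\<in>S. f i x\<bar>)"
      by (rule integrable_cong_AE_imp) (use prod_eq in \<open>auto elim: eventually_mono\<close>)
    then show ?thesis
      by (simp add: Lp_def)
  qed
  have dev_Lp: "d i \<in> Lp M 2" if "i \<in> S" for i
    using d_sq[OF that] that by (simp add: Lp_def)

  \<comment> \<open>The roles cross: the lower bound on the squared mean bounds the variance above,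
    hence the integral of \<open>G2\<close> above. The factor \<open>p_max / (p_max - 1)\<close> is
    \<open>1 / (1 - c)\<close>.\<close>
  have "V \<le> (LINT x|M. (1 - c) * (E2 x - G2 x))"
    unfolding V
  proof (rule integral_mono)
    show "(\<Sum>i\<in>S. w i * (d i x)\<^sup>2) \<le> (1 - c) * (E2 x - G2 x)" for x
      unfolding var using lower[of x] by (simp add: algebra_simps)
  qed (use V_integrable E2 G2 in auto)
  then have "V \<le> (1 - c) * (1 - (LINT x|M. G2 x))"
    using E2 G2 by simp
  then have upper_G2: "(LINT x|M. G2 x) \<le> 1 - p_max / (p_max - 1) * V"
    using p_max_gt_1 by (simp add: c_def field_simps)
  \<comment> \<open>Likewise the upper bound on the squared mean gives the lower inequality, with
    factor \<open>p_max = 1 / c\<close>. The positive part then comes from \<open>G2\<close> being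
    nonnegative.\<close>
  have "(LINT x|M. c * (E2 x - G2 x)) \<le> V"
    unfolding V
  proof (rule integral_mono)
    show "c * (E2 x - G2 x) \<le> (\<Sum>i\<in>S. w i * (d i x)\<^sup>2)" for x
      unfolding var using upper[of x] by (simp add: algebra_simps)
  qed (use V_integrable E2 G2 in auto)
  then have "c * (1 - (LINT x|M. G2 x)) \<le> V"
    using E2 G2 by simp
  then have "1 - p_max * V \<le> (LINT x|M. G2 x)"
    using p_max_gt_1 by (simp add: c_def field_simps)
  then have lower_G2: "max (1 - p_max * V) 0 \<le> (LINT x|M. G2 x)"
    using G2_nonneg by simp
  have "0 \<le> N"
    unfolding N_def using p by (intro prod_nonneg) (auto simp: less_imp_le)
  then have "N * max (1 - p_max * V) 0 \<le> Lp_norm M 1 (\<lambda>x. \<Prod>i\<in>S. f i x)"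
      "Lp_norm M 1 (\<lambda>x. \<Prod>i\<in>S. f i x) \<le> N * (1 - p_max / (p_max - 1) * V)"
    unfolding norm_1 using lower_G2 upper_G2 by (simp_all only: mult_left_mono)
  moreover have V_eq: "(\<Sum>i=1..n. 1 / p i * (Lp_norm M 2 (deviation M n p f i))\<^sup>2) = V"
    by (simp add: V_def Lp_norm_2_sq d_def w_def S_def)
  ultimately show ?thesis
    using prod_Lp dev_Lp unfolding V_eq unfolding N_def S_def d_def by blast
qed

end
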